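(* Let $a\in C^1([-1,1])$ with $a>0$ on $(-1,1)$ and $a(-1)=a(1)=0$, and let $\xi_a(x)=\int_0^x\frac{ds}{a(s)}$. Let $T>0$, $p\ge1$ and $Q_T=(0,T)\times(-1,1)$. If $\xi_a\in L^{2p-1}(-1,1)$, then $$H^1(0,T;L^2(-1,1))\cap L^\infty(0,T;H^1_a(-1,1))\subset L^{2p}(Q_T),$$ and there is a positive constant $c$ such that for all $u$ in the space on the left $$\|u\|_{L^{2p}(Q_T)}\le c\,T^{\frac1{2p}}\,\|u\|_{H^1(0,T;L^2(-1,1))}^{\frac1{2p}}\,\|u\|_{L^\infty(0,T;H^1_a(-1,1))}^{1-\frac1{2p}} .$$
   Context: $H^1_a(-1,1)=\{u\in L^2(-1,1): u$ is locally absolutely continuous in $(-1,1)$ and $\sqrt a\,u_x\in L^2(-1,1)\}$, with norm $\|u\|_{1,a}^2=\|u\|_{L^2(-1,1)}^2+\|\sqrt a\,u_x\|_{L^2(-1,1)}^2$. The norms used are $\|u\|_{H^1(0,T;L^2(-1,1))}^2=\sup_{[0,T]}\|u\|_{L^2(-1,1)}^2+\int_0^T\|u_t\|_{L^2(-1,1)}^2dt$ and $\|u\|_{L^\infty(0,T;H^1_a(-1,1))}^2=\sup_{[0,T]}\big(\|u\|_{L^2(-1,1)}^2+\|\sqrt a\,u_x\|_{L^2(-1,1)}^2\big)$ (essential supremum). The constant $c$ does not depend on $u$. *)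

theory Defs
  imports "HOL-Analysis.Analysis" "HOL-Probability.Essential_Supremum"
begin

text \<open>Derivatives at points of S are taken within S, hence one-sided at the end points of an
  interval.\<close>

definition C1_on :: "real set \<Rightarrow> (real \<Rightarrow> real) \<Rightarrow> bool" where
  "C1_on S f \<longleftrightarrow> (\<exists>f'. continuous_on S f' \<and>
     (\<forall>x\<in>S. (f has_real_derivative f' x) (at x within S)))"

text \<open>Elements of Lebesgue spaces are represented by Lebesgue measurable functions; equality of
  elements is equality almost everywhere.\<close>

definition Lp :: "'a measure \<Rightarrow> real \<Rightarrow> ('a \<Rightarrow> real) set" where
  "Lp M q = {f \<in> borel_measurable M. integrable M (\<lambda>x. \<bar>f x\<bar> powr q)}"

definition Lp_norm :: "'a measure \<Rightarrow> real \<Rightarrow> ('a \<Rightarrow> real) \<Rightarrow> real" where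
  "Lp_norm M q f = (LINT x|M. \<bar>f x\<bar> powr q) powr (1 / q)"

abbreviation space_meas :: "real measure" where
  "space_meas \<equiv> lebesgue_on {-1<..<1}"

abbreviation time_meas :: "real \<Rightarrow> real measure" where
  "time_meas T \<equiv> lebesgue_on {0<..<T}"

abbreviation cyl_meas :: "real \<Rightarrow> (real \<times> real) measure" where
  "cyl_meas T \<equiv> lebesgue_on ({0<..<T} \<times> {-1<..<1})"

abbreviation L2 :: "(real \<Rightarrow> real) set" where
  "L2 \<equiv> Lp space_meas 2"

abbreviation L2_norm :: "(real \<Rightarrow> real) \<Rightarrow> real" where
  "L2_norm \<equiv> Lp_norm space_meas 2"

definition xi :: "(real \<Rightarrow> real) \<Rightarrow> real \<Rightarrow> real" where
  "xi a x = (LBINT s=0..x. 1 / a s)"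

definition abs_continuous_on :: "real \<Rightarrow> real \<Rightarrow> (real \<Rightarrow> real) \<Rightarrow> bool" where
  "abs_continuous_on c d f \<longleftrightarrow>
     (\<forall>\<epsilon>>0. \<exists>\<delta>>0. \<forall>I :: (real \<times> real) set.
        finite I \<and> (\<forall>(x, y)\<in>I. c \<le> x \<and> x \<le> y \<and> y \<le> d) \<and>
        disjoint_family_on (\<lambda>(x, y). {x<..<y}) I \<and> (\<Sum>(x, y)\<in>I. y - x) < \<delta>
        \<longrightarrow> (\<Sum>(x, y)\<in>I. \<bar>f y - f x\<bar>) < \<epsilon>)"

definition loc_abs_continuous :: "(real \<Rightarrow> real) \<Rightarrow> bool" where
  "loc_abs_continuous f \<longleftrightarrow> (\<forall>c d. -1 < c \<and> c < d \<and> d < 1 \<longrightarrow> abs_continuous_on c d f)"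

text \<open>The derivative of a locally absolutely continuous function is its classical derivative, which
  exists almost everywhere. As u stands for an equivalence class, local absolute continuity is
  asked of a representative w of the class.\<close>

definition has_x_deriv :: "(real \<Rightarrow> real) \<Rightarrow> (real \<Rightarrow> real) \<Rightarrow> bool" where
  "has_x_deriv u g \<longleftrightarrow> (\<exists>w. loc_abs_continuous w \<and> (AE x in space_meas. u x = w x) \<and>
     (AE x in space_meas. (w has_real_derivative g x) (at x)))"

definition x_deriv :: "(real \<Rightarrow> real) \<Rightarrow> real \<Rightarrow> real" where
  "x_deriv u = (SOME g. has_x_deriv u g)"

definition H1a :: "(real \<Rightarrow> real) \<Rightarrow> (real \<Rightarrow> real) set" where
  "H1a a = {u \<in> L2. (\<exists>g. has_x_deriv u g) \<and> (\<lambda>x. sqrt (a x) * x_deriv u x) \<in> L2}"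

definition H1a_norm :: "(real \<Rightarrow> real) \<Rightarrow> (real \<Rightarrow> real) \<Rightarrow> real" where
  "H1a_norm a u = sqrt ((L2_norm u)\<^sup>2 + (L2_norm (\<lambda>x. sqrt (a x) * x_deriv u x))\<^sup>2)"

text \<open>Strong (Bochner) measurability of t |-> u t from (0,T) into the space X of (classes of)
  functions on (-1,1) with norm N: almost everywhere limit in N of X-valued simple functions. Such
  a map is identified with a function on the cylinder, which is why the representative u is also
  taken to be jointly measurable.\<close>

definition bochner_measurable ::
  "real \<Rightarrow> (real \<Rightarrow> real) set \<Rightarrow> ((real \<Rightarrow> real) \<Rightarrow> real) \<Rightarrow> (real \<Rightarrow> real \<Rightarrow> real) \<Rightarrow> bool" where
  "bochner_measurable T X N u \<longleftrightarrow>
     case_prod u \<in> borel_measurable (cyl_meas T) \<and>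
     (AE t in time_meas T. u t \<in> X) \<and>
     (\<exists>s :: nat \<Rightarrow> real \<Rightarrow> real \<Rightarrow> real.
        (\<forall>n. simple_function (time_meas T) (s n) \<and> (\<forall>t\<in>{0<..<T}. s n t \<in> X)) \<and>
        (AE t in time_meas T. (\<lambda>n. N (\<lambda>x. s n t x - u t x)) \<longlonglongrightarrow> 0))"

definition L2_L2 :: "real \<Rightarrow> (real \<Rightarrow> real \<Rightarrow> real) set" where
  "L2_L2 T = {u. bochner_measurable T L2 L2_norm u \<and>
     integrable (time_meas T) (\<lambda>t. (L2_norm (u t))\<^sup>2)}"

definition test_function :: "real \<Rightarrow> (real \<Rightarrow> real) \<Rightarrow> bool" where
  "test_function T \<phi> \<longleftrightarrow> (\<forall>n t. (deriv ^^ n) \<phi> field_differentiable (at t)) \<and>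
     (\<exists>K. compact K \<and> K \<subseteq> {0<..<T} \<and> (\<forall>t. t \<notin> K \<longrightarrow> \<phi> t = 0))"

text \<open>Weak derivative of an L2(-1,1)-valued function of time. The two sides are the Bochner
  integrals of u times the derivative of the test function and of minus v times the test function;
  for jointly measurable representatives in L2(0,T;L2(-1,1)) the values of these integrals at x are
  given by the scalar integrals below, and equality in L2(-1,1) is equality for almost every x.\<close>

definition has_t_deriv :: "real \<Rightarrow> (real \<Rightarrow> real \<Rightarrow> real) \<Rightarrow> (real \<Rightarrow> real \<Rightarrow> real) \<Rightarrow> bool" where
  "has_t_deriv T u v \<longleftrightarrow> v \<in> L2_L2 T \<and>
     (\<forall>\<phi>. test_function T \<phi> \<longrightarrow>
        (AE x in space_meas.
           (LINT t|time_meas T. u t x * deriv \<phi> t) = - (LINT t|time_meas T. v t x * \<phi> t)))"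

definition t_deriv :: "real \<Rightarrow> (real \<Rightarrow> real \<Rightarrow> real) \<Rightarrow> real \<Rightarrow> real \<Rightarrow> real" where
  "t_deriv T u = (SOME v. has_t_deriv T u v)"

definition H1_L2 :: "real \<Rightarrow> (real \<Rightarrow> real \<Rightarrow> real) set" where
  "H1_L2 T = {u \<in> L2_L2 T. \<exists>v. has_t_deriv T u v}"

text \<open>The essential supremum does not depend on the representative; for u in H1(0,T;L2(-1,1)) the
  essential supremum of the L2 norm is the supremum over [0,T] for the continuous representative.\<close>

definition H1_L2_norm :: "real \<Rightarrow> (real \<Rightarrow> real \<Rightarrow> real) \<Rightarrow> real" where
  "H1_L2_norm T u =
     sqrt (real_of_ereal (esssup (time_meas T) (\<lambda>t. ereal ((L2_norm (u t))\<^sup>2)))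
           + (LINT t|time_meas T. (L2_norm (t_deriv T u t))\<^sup>2))"

definition Linf_H1a :: "(real \<Rightarrow> real) \<Rightarrow> real \<Rightarrow> (real \<Rightarrow> real \<Rightarrow> real) set" where
  "Linf_H1a a T = {u. bochner_measurable T (H1a a) (H1a_norm a) u \<and>
     esssup (time_meas T) (\<lambda>t. ereal ((H1a_norm a (u t))\<^sup>2)) < \<infinity>}"

definition Linf_H1a_norm :: "(real \<Rightarrow> real) \<Rightarrow> real \<Rightarrow> (real \<Rightarrow> real \<Rightarrow> real) \<Rightarrow> real" where
  "Linf_H1a_norm a T u =
     sqrt (real_of_ereal (esssup (time_meas T) (\<lambda>t. ereal ((H1a_norm a (u t))\<^sup>2))))"

end

(* For almost every t the slice u(t) has a locally absolutely continuous representative w. The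
   Cauchy-Schwarz inequality for w(x) - w(0) = int_0^x (1 / sqrt a) (sqrt a w') gives
   (w(x) - w(0))^2 <= |xi_a(x)| ||sqrt a w'||^2, and averaging over [0, 1/2] bounds w(0), so that
   u(t,x)^2 <= ||u(t)||_{1,a}^2 (B + 2 |xi_a(x)|). Writing |u|^(2p) = |u| |u|^(2p-1) and using
   Cauchy-Schwarz once more, the integral of |u(t)|^(2p) is at most
   C ||u(t)||_{L^2} ||u(t)||_{1,a}^(2p-1), where C comes from the integral of |xi_a|^(2p-1).
   Integrating in t gives the claim. *)
theory Submission
  imports Defs
begin

section \<open>Fundamental theorem of calculus for absolutely continuous functions\<close>

text \<open>Riemann sums of g are compared with the telescoping sum of increments of w. Tags outside
  E cost an error proportional to the interval length; tags in E carry increments over intervals of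
  small total length. With the gauge integral, integrability of g is a conclusion and not a
  hypothesis.\<close>

lemma abs_continuous_on_has_integral:
  fixes w g :: "real \<Rightarrow> real"
  assumes ac: "abs_continuous_on c d w" and cd: "c \<le> d" and E: "negligible E"
    and der: "\<And>x. x \<in> {c..d} - E \<Longrightarrow> (w has_real_derivative g x) (at x)"
  shows "(g has_integral (w d - w c)) {c..d}"
proof -
  \<comment> \<open>Setting g to 0 on E leaves only the increment of w at a tag in E. The change on
    a null set is undone at the end by \<open>has_integral_spike\<close>.\<close>
  define g' where "g' = (\<lambda>x. if x \<in> E then 0 else g x)"
  have "(g' has_integral (w d - w c)) {c..d}"
    unfolding has_integral_real
  proof (intro allI impI)
    fix e :: real
    assume e: "e > 0"
    \<comment> \<open>Half of e is reserved for tags outside E, half for tags in E. The added 1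
      covers c = d and makes the first half strict.\<close>
    define e1 where "e1 = e / (2 * (d - c + 1))"
    have e1: "e1 > 0" "e1 * (d - c) < e / 2"
      using e cd by (simp_all add: e1_def field_simps)
    have "\<forall>x. \<exists>r>0. x \<in> {c..d} - E \<longrightarrow>
        (\<forall>y. \<bar>y - x\<bar> < r \<longrightarrow> \<bar>w y - w x - (y - x) * g x\<bar> \<le> e1 * \<bar>y - x\<bar>)"
    proof
      fix x
      show "\<exists>r>0. x \<in> {c..d} - E \<longrightarrow>
        (\<forall>y. \<bar>y - x\<bar> < r \<longrightarrow> \<bar>w y - w x - (y - x) * g x\<bar> \<le> e1 * \<bar>y - x\<bar>)"
      proof (cases "x \<in> {c..d} - E")
        case True
        from der[OF this] e1(1) obtain r where "r > 0"
          "\<forall>y. norm (y - x) < r \<longrightarrow> norm (w y - w x - g x * (y - x)) \<le> e1 * norm (y - x)"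
          unfolding has_field_derivative_def has_derivative_at_alt by meson
        then show ?thesis by (intro exI[of _ r]) (auto simp: mult.commute)
      qed (use zero_less_one in blast)
    qed
    then obtain r where r: "\<And>x. r x > 0"
      "\<And>x y. x \<in> {c..d} - E \<Longrightarrow> \<bar>y - x\<bar> < r x \<Longrightarrow> \<bar>w y - w x - (y - x) * g x\<bar> \<le> e1 * \<bar>y - x\<bar>"
      by metis
    have "e / 2 > 0" using e by simp
    then obtain \<delta> where \<delta>: "\<delta> > 0"
      "\<And>I :: (real \<times> real) set. finite I \<Longrightarrow> (\<forall>(x, y)\<in>I. c \<le> x \<and> x \<le> y \<and> y \<le> d) \<Longrightarrow>
        disjoint_family_on (\<lambda>(x, y). {x<..<y}) I \<Longrightarrow> (\<Sum>(x, y)\<in>I. y - x) < \<delta>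
        \<Longrightarrow> (\<Sum>(x, y)\<in>I. \<bar>w y - w x\<bar>) < e / 2"
      using ac unfolding abs_continuous_on_def by meson
    have Enull: "E \<in> null_sets lebesgue"
      using E negligible_iff_null_sets by blast
    obtain U where U: "open U" "E \<subseteq> U" "(U - E) \<in> lmeasurable"
        "emeasure lebesgue (U - E) < ennreal \<delta>"
      using sets_lebesgue_outer_open[of E \<delta>] Enull \<delta>(1) by blast
    have Us: "U \<in> sets lebesgue" using U(1) by simp
    have emU: "emeasure lebesgue U < ennreal \<delta>"
      using U(4) emeasure_Diff_null_set[OF Enull Us] by simp
    (* Tags in E only see intervals inside a small open set, on which absolute continuity controls
       the increments of w; the other tags are handled by differentiability. *)
    define \<gamma> where "\<gamma> x = (if x \<in> E then U else ball x (r x))" for x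
    have gauge: "gauge \<gamma>"
      using U(1,2) r(1) by (auto simp: gauge_def \<gamma>_def)
    have close: "norm ((\<Sum>(x, K)\<in>p. measure lborel K *\<^sub>R g' x) - (w d - w c)) < e"
      if ptag: "p tagged_division_of {c..d}" and fine: "\<gamma> fine p" for p
    proof -
      have finp: "finite p" using ptag by auto
      have Kform: "\<exists>u v. K = {u..v} \<and> u \<le> v \<and> c \<le> u \<and> v \<le> d \<and> x \<in> K \<and> K \<subseteq> \<gamma> x \<and> x \<in> {c..d}"
        if "(x, K) \<in> p" for x K
      proof -
        obtain u v where "K = {u..v}"
          using ptag \<open>(x, K) \<in> p\<close> by (metis cbox_interval tagged_division_ofD(4))
        moreover have "x \<in> K" "K \<subseteq> {c..d}" using ptag \<open>(x, K) \<in> p\<close> by auto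
        moreover have "K \<subseteq> \<gamma> x" using fine \<open>(x, K) \<in> p\<close> by (auto simp: fine_def)
        ultimately show ?thesis by force
      qed
      \<comment> \<open>Degenerate intervals carry no increment of w and are dropped. Distinct
        members of q then have disjoint nonempty interiors, which makes the end-point map
        \<open>\<iota>\<close> injective and lets the sum over q be read as a sum over a set of
        pairs.\<close>
      define q where "q = {z \<in> p. fst z \<in> E \<and> Inf (snd z) < Sup (snd z)}"
      have finq: "finite q" using finp by (simp add: q_def)
      define \<iota> where "\<iota> = (\<lambda>z :: real \<times> real set. (Inf (snd z), Sup (snd z)))"
      have qform: "\<exists>u v. K = {u..v} \<and> u < v \<and> c \<le> u \<and> v \<le> d \<and> K \<subseteq> U \<and> \<iota> (x, K) = (u, v)"
        if xK: "(x, K) \<in> q" for x K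
      proof -
        obtain u v where uv: "K = {u..v}" "u \<le> v" "c \<le> u" "v \<le> d" "K \<subseteq> \<gamma> x"
          using Kform[of x K] xK by (auto simp: q_def)
        with xK show ?thesis by (auto simp: q_def \<iota>_def \<gamma>_def)
      qed
      have disj: "{u<..<v} \<inter> {u'<..<v'} = {}"
        if "(x, {u..v}) \<in> p" "(x', {u'..v'}) \<in> p" "(x, {u..v}) \<noteq> (x', {u'..v'})" for x x' u v u' v'
        using tagged_division_ofD(5)[OF ptag that] by simp
      have inj: "inj_on \<iota> q"
      proof (rule inj_onI)
        fix z z' assume z: "z \<in> q" "z' \<in> q" "\<iota> z = \<iota> z'"
        obtain x K where xK: "z = (x, K)" by force
        obtain x' K' where xK': "z' = (x', K')" by force
        obtain u v where uv: "K = {u..v}" "u < v" "\<iota> z = (u, v)"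
          using qform z xK by blast
        obtain u' v' where uv': "K' = {u'..v'}" "u' < v'" "\<iota> z' = (u', v')"
          using qform z xK' by blast
        have "u' = u" "v' = v" using uv uv' z by auto
        moreover have "{u<..<v} \<noteq> {}" using uv(2) by simp
        ultimately show "z = z'"
          using disj[of x u v x' u' v'] z xK xK' uv uv' by (auto simp: q_def)
      qed
      define I where "I = \<iota> ` q"
      have finI: "finite I" using finq by (simp add: I_def)
      have Iin: "\<forall>(x, y)\<in>I. c \<le> x \<and> x \<le> y \<and> y \<le> d"
        using qform by (fastforce simp: I_def)
      have dI: "disjoint_family_on (\<lambda>(x, y). {x<..<y}) I"
        unfolding disjoint_family_on_def
      proof (intro ballI impI)
        fix m n assume mn: "m \<in> I" "n \<in> I" "m \<noteq> n"
        obtain x K where xK: "(x, K) \<in> q" "m = \<iota> (x, K)" using mn by (auto simp: I_def)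
        obtain x' K' where xK': "(x', K') \<in> q" "n = \<iota> (x', K')" using mn by (auto simp: I_def)
        obtain u v where uv: "K = {u..v}" "m = (u, v)" using qform xK by metis
        obtain u' v' where uv': "K' = {u'..v'}" "n = (u', v')" using qform xK' by metis
        show "(case m of (x, y) \<Rightarrow> {x<..<y}) \<inter> (case n of (x, y) \<Rightarrow> {x<..<y}) = {}"
          using disj[of x u v x' u' v'] mn(3) xK xK' uv uv' by (auto simp: q_def)
      qed
      have IU: "(\<Union>i\<in>I. (\<lambda>(x, y). {x<..<y}) i) \<subseteq> U"
        using qform by (fastforce simp: I_def)
      \<comment> \<open>The total length is the measure of a disjoint union of open intervals inside
        U.\<close>
      have "(\<Sum>(x, y)\<in>I. y - x) < \<delta>"
      proof -
        have "ennreal (\<Sum>(x, y)\<in>I. y - x) = (\<Sum>i\<in>I. ennreal (case i of (x, y) \<Rightarrow> y - x))"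
          using Iin by (subst sum_ennreal) auto
        also have "\<dots> = (\<Sum>i\<in>I. emeasure lebesgue ((\<lambda>(x, y). {x<..<y}) i))"
          using Iin by (intro sum.cong) auto
        also have "\<dots> = emeasure lebesgue (\<Union>i\<in>I. (\<lambda>(x, y). {x<..<y}) i)"
          using dI finI by (intro sum_emeasure) auto
        also have "\<dots> \<le> emeasure lebesgue U"
          using IU Us by (rule emeasure_mono)
        also note emU
        finally have "ennreal (\<Sum>(x, y)\<in>I. y - x) < ennreal \<delta>" .
        moreover have "0 \<le> (\<Sum>(x, y)\<in>I. y - x)"
          using Iin by (intro sum_nonneg) auto
        ultimately show ?thesis by (simp add: ennreal_less_iff)
      qed
      then have "(\<Sum>(x, y)\<in>I. \<bar>w y - w x\<bar>) < e / 2"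
        using \<delta>(2)[OF finI Iin dI] by blast
      then have qsum: "(\<Sum>z\<in>q. \<bar>w (Sup (snd z)) - w (Inf (snd z))\<bar>) < e / 2"
        unfolding I_def sum.reindex[OF inj] by (simp add: \<iota>_def o_def)
      have tele: "d - c = (\<Sum>(x, K)\<in>p. Sup K - Inf K)" "w d - w c = (\<Sum>(x, K)\<in>p. w (Sup K) - w (Inf K))"
        using additive_tagged_division_1[OF cd ptag, of "\<lambda>x. x"]
          additive_tagged_division_1[OF cd ptag, of w] by auto
      have "norm ((\<Sum>(x, K)\<in>p. measure lborel K *\<^sub>R g' x) - (w d - w c))
          = \<bar>\<Sum>(x, K)\<in>p. measure lborel K * g' x - (w (Sup K) - w (Inf K))\<bar>"
        unfolding tele by (simp add: sum_subtractf split_def)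
      also have "\<dots> \<le> (\<Sum>z\<in>p. \<bar>case z of (x, K) \<Rightarrow> measure lborel K * g' x - (w (Sup K) - w (Inf K))\<bar>)"
        by (rule sum_abs)
      also have "\<dots> \<le> (\<Sum>z\<in>p. e1 * (Sup (snd z) - Inf (snd z)) +
            (if z \<in> q then \<bar>w (Sup (snd z)) - w (Inf (snd z))\<bar> else 0))"
      proof (rule sum_mono)
        fix z assume zp: "z \<in> p"
        obtain x K where z: "z = (x, K)" by force
        then obtain u v where uv: "K = {u..v}" "u \<le> v" "c \<le> u" "v \<le> d" "x \<in> K" "K \<subseteq> \<gamma> x" "x \<in> {c..d}"
          using Kform zp by blast
        have e1uv: "e1 * (v - u) \<ge> 0" using e1 uv by simp
        show "\<bar>case z of (x, K) \<Rightarrow> measure lborel K * g' x - (w (Sup K) - w (Inf K))\<bar>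
          \<le> e1 * (Sup (snd z) - Inf (snd z)) +
            (if z \<in> q then \<bar>w (Sup (snd z)) - w (Inf (snd z))\<bar> else 0)"
        proof (cases "x \<in> E")
          case True
          then show ?thesis
            using z zp uv e1uv by (cases "u = v") (auto simp: q_def g'_def)
        next
          case False
          then have near: "\<bar>u - x\<bar> < r x" "\<bar>v - x\<bar> < r x"
            using uv(2,6) subsetD[OF uv(6), of u] subsetD[OF uv(6), of v] uv(1,2)
            by (simp_all add: \<gamma>_def dist_real_def abs_minus_commute)
          have x: "x \<in> {c..d} - E" using uv(7) False by blast
          \<comment> \<open>Straddle estimate: the tag lies in [u, v], so its distances to the two
            end points add up to exactly v - u.\<close>
          note r(2)[OF x near(1)] r(2)[OF x near(2)]
          moreover have "e1 * \<bar>u - x\<bar> + e1 * \<bar>v - x\<bar> = e1 * (v - u)"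
            using uv by (simp add: algebra_simps)
          moreover have "(v - u) * g x - (w v - w u) = (w u - w x - (u - x) * g x) - (w v - w x - (v - x) * g x)"
            by (simp add: algebra_simps)
          ultimately have "\<bar>(v - u) * g x - (w v - w u)\<bar> \<le> e1 * (v - u)" by linarith
          then show ?thesis using z uv False by (auto simp: g'_def q_def)
        qed
      qed
      also have "\<dots> = e1 * (d - c) + (\<Sum>z\<in>q. \<bar>w (Sup (snd z)) - w (Inf (snd z))\<bar>)"
      proof -
        have "(\<Sum>z\<in>p. if z \<in> q then \<bar>w (Sup (snd z)) - w (Inf (snd z))\<bar> else 0)
            = (\<Sum>z\<in>q. \<bar>w (Sup (snd z)) - w (Inf (snd z))\<bar>)"
          using finp by (intro sum.mono_neutral_cong_right) (auto simp: q_def)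
        then show ?thesis
          unfolding tele(1) by (simp add: sum.distrib sum_distrib_left split_def)
      qed
      also have "\<dots> < e" using e1(2) qsum by simp
      finally show ?thesis .
    qed
    show "\<exists>\<gamma>. gauge \<gamma> \<and> (\<forall>D. D tagged_division_of {c..d} \<and> \<gamma> fine D \<longrightarrow>
        norm ((\<Sum>(x, K)\<in>D. measure lborel K *\<^sub>R g' x) - (w d - w c)) < e)"
      by (intro exI[of _ \<gamma>] conjI allI impI gauge; elim conjE; rule close)
  qed
  then show ?thesis
    by (rule has_integral_spike[OF E, rotated]) (auto simp: g'_def)
qed

section \<open>From bounds on time slices to a bound on the cylinder\<close>

(* The Lebesgue measure on a product is only the completion of the product measure, so Tonelli's
   theorem is applied to a Borel version of F. *)
lemma nn_integral_lebesgue_on_Times_le: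
  fixes F :: "'a::euclidean_space \<times> 'b::euclidean_space \<Rightarrow> ennreal"
  assumes S: "S \<in> sets borel" and R: "R \<in> sets borel"
    and F: "F \<in> borel_measurable (lebesgue_on (S \<times> R))"
    and le: "AE t in lebesgue_on S. (\<integral>\<^sup>+x. F (t, x) \<partial>lebesgue_on R) \<le> K"
  shows "(\<integral>\<^sup>+z. F z \<partial>lebesgue_on (S \<times> R)) \<le> K * emeasure lborel S"
proof -
  have SR: "S \<times> R \<in> sets borel" using S R by (rule borel_Times)
  define F0 where "F0 z = F z * indicator (S \<times> R) z" for z
  have "F0 \<in> borel_measurable lebesgue"
    using F SR unfolding F0_def
    by (subst (asm) borel_measurable_restrict_space_iff_ennreal) auto
  then obtain F' where F': "F' \<in> borel_measurable lborel" "AE z in lborel. F0 z = F' z"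
    using completion_ex_borel_measurable by blast
  have F'm: "F' \<in> borel_measurable (lborel \<Otimes>\<^sub>M lborel)"
    using F'(1) by (simp add: lborel_prod)
  \<comment> \<open>An exceptional null set in the product has null slices for almost every t, so on
    almost every slice F0 may be replaced by its Borel version.\<close>
  have "AE t in lborel. AE x in lborel. F0 (t, x) = F' (t, x)"
    by (rule lborel_pair.AE_pair) (unfold lborel_prod, rule F'(2))
  moreover have "AE t in lborel. t \<in> S \<longrightarrow> (\<integral>\<^sup>+x. F (t, x) \<partial>lebesgue_on R) \<le> K"
    using le S by (simp add: AE_restrict_space_iff AE_completion_iff)
  ultimately have slice: "AE t in lborel. (\<integral>\<^sup>+x. F' (t, x) \<partial>lborel) \<le> K * indicator S t"
  proof eventually_elim
    case (elim t)
    have "(\<integral>\<^sup>+x. F' (t, x) \<partial>lborel) = (\<integral>\<^sup>+x. F0 (t, x) \<partial>lborel)"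
      using elim(1) by (intro nn_integral_cong_AE) auto
    also have "\<dots> = (\<integral>\<^sup>+x. F0 (t, x) \<partial>lebesgue)"
      by (simp add: nn_integral_completion)
    also have "\<dots> = (\<integral>\<^sup>+x. (F (t, x) * indicator R x) * indicator S t \<partial>lebesgue)"
      by (intro nn_integral_cong) (auto simp: F0_def indicator_def)
    also have "\<dots> \<le> K * indicator S t"
      using elim(2) R by (cases "t \<in> S") (auto simp: nn_integral_restrict_space)
    finally show ?case .
  qed
  have "(\<integral>\<^sup>+z. F z \<partial>lebesgue_on (S \<times> R)) = (\<integral>\<^sup>+z. F0 z \<partial>lebesgue)"
    using SR by (simp add: nn_integral_restrict_space F0_def)
  also have "\<dots> = (\<integral>\<^sup>+z. F0 z \<partial>lborel)" by (simp add: nn_integral_completion)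
  also have "\<dots> = (\<integral>\<^sup>+z. F' z \<partial>lborel)" using F'(2) by (rule nn_integral_cong_AE)
  also have "\<dots> = (\<integral>\<^sup>+t. \<integral>\<^sup>+x. F' (t, x) \<partial>lborel \<partial>lborel)"
    using lborel.nn_integral_fst[OF F'm] by (simp add: lborel_prod)
  also have "\<dots> \<le> (\<integral>\<^sup>+t. K * indicator S t \<partial>lborel)"
    using slice by (rule nn_integral_mono_AE)
  also have "\<dots> = K * emeasure lborel S"
    using S by (simp add: nn_integral_cmult_indicator)
  finally show ?thesis .
qed

section \<open>Elementary facts on squares and square integrability\<close>

lemma Lp_2_iff: "f \<in> Lp M 2 \<longleftrightarrow> f \<in> borel_measurable M \<and> integrable M (\<lambda>x. (f x)\<^sup>2)"
  by (simp add: Lp_def powr_realpow')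

lemma Lp_norm_2_sq: "(Lp_norm M 2 f)\<^sup>2 = (LINT x|M. (f x)\<^sup>2)"
  by (simp add: Lp_norm_def powr_realpow' powr_half_sqrt)

(* Replaces the Cauchy-Schwarz inequality for Henstock-Kurzweil integrals: only the pointwise AM-GM
   bound with parameter l is integrated. *)
lemma sq_le_mult_of_quadratic:
  fixes D J N :: real
  assumes D: "D \<ge> 0" and N: "N \<ge> 0" and quad: "\<And>l. l > 0 \<Longrightarrow> 2 * l * D \<le> l\<^sup>2 * N + J"
  shows "D\<^sup>2 \<le> J * N"
proof (cases "D = 0")
  case True
  have "J \<ge> 0"
  proof (rule field_le_epsilon)
    fix e :: real assume e: "e > 0"
    \<comment> \<open>With D = 0 the hypothesis reads 0 <= l^2 N + J. This l makes l^2 N at most e;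
      the added 1 guards against N = 0.\<close>
    define l where "l = sqrt (e / (N + 1))"
    have "l > 0" "l\<^sup>2 * N \<le> e" using e N by (auto simp: l_def field_simps)
    then show "0 \<le> J + e" using quad[of l] True by simp
  qed
  then show ?thesis using True N by simp
next
  case False
  then have D: "D > 0" using D by simp
  show ?thesis
  proof (cases "N = 0")
    case True
    have J: "J > 0" using quad[of 1] D True by simp
    \<comment> \<open>The case N = 0 is contradictory: l = J / D gives 2 J <= J, against J >
      0.\<close>
    have "2 * (J / D) * D \<le> J"
      using quad[of "J / D"] J D True by simp
    then show ?thesis using J D by simp
  next
    case False
    then have N: "N > 0" using N by simp
    \<comment> \<open>l = D / N minimises l^2 N - 2 l D.\<close>
    have "2 * (D / N) * D \<le> (D / N)\<^sup>2 * N + J"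
      using D N by (intro quad) simp
    then show ?thesis using N by (simp add: field_simps power2_eq_square)
  qed
qed

lemma ennreal_le_of_sq_le:
  assumes "x\<^sup>2 \<le> (ennreal r)\<^sup>2" and "r \<ge> 0"
  shows "x \<le> ennreal r"
  using assms by (cases x) (auto simp: ennreal_power ennreal_le_iff top_unique intro: power2_le_imp_le)

section \<open>Weighted estimates for a single time slice\<close>

context
  fixes a :: "real \<Rightarrow> real"
  assumes a_pos: "\<And>x. x \<in> {-1<..<1} \<Longrightarrow> a x > 0"
    and a_cont: "continuous_on {-1<..<1} a"
begin

lemma continuous_inverse_weight: "{c..d} \<subseteq> {-1<..<1} \<Longrightarrow> continuous_on {c..d} (\<lambda>s. 1 / a s)"
  using a_pos by (intro continuous_intros continuous_on_subset[OF a_cont]) force+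

text \<open>Translates the signed Lebesgue integral defining \<open>xi\<close> into gauge integrals,
  the form in which increments of w are bounded.\<close>

lemma xi_eq_integral:
  assumes "x \<in> {-1<..<1}"
  shows "xi a x = (if 0 \<le> x then integral {0..x} (\<lambda>s. 1 / a s) else - integral {x..0} (\<lambda>s. 1 / a s))"
proof (cases "0 \<le> x")
  case True
  then have "set_integrable lborel {0..x} (\<lambda>s. 1 / a s)"
    using assms by (intro borel_integrable_atLeastAtMost' continuous_inverse_weight) auto
  then show ?thesis
    using True interval_integral_eq_integral[OF True] by (simp add: xi_def zero_ereal_def)
next
  case False
  then have "set_integrable lborel {x..0} (\<lambda>s. 1 / a s)"
    using assms by (intro borel_integrable_atLeastAtMost' continuous_inverse_weight) auto
  then show ?thesis
    using False interval_integral_eq_integral[of x 0 "\<lambda>s. 1 / a s"]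
      interval_integral_endpoints_reverse[of "ereal 0" x "\<lambda>s. 1 / a s"]
    by (simp add: xi_def zero_ereal_def)
qed

text \<open>Cauchy-Schwarz for the product of 1 / sqrt a and sqrt a g, whose integral over [c, d] is
  the increment of w. Since [c, d] stays inside the open interval, 1 / a is continuous on
  it.\<close>

lemma loc_abs_continuous_increment_sq_le:
  assumes w: "loc_abs_continuous w"
    and der: "AE x in space_meas. (w has_real_derivative g x) (at x)"
    and g: "(\<lambda>x. sqrt (a x) * g x) \<in> L2"
    and cd: "-1 < c" "c \<le> d" "d < 1"
  shows "(w d - w c)\<^sup>2 \<le> integral {c..d} (\<lambda>s. 1 / a s) * (L2_norm (\<lambda>x. sqrt (a x) * g x))\<^sup>2"
proof (cases "c = d")
  case False
  let ?N = "(L2_norm (\<lambda>x. sqrt (a x) * g x))\<^sup>2"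
  let ?J = "integral {c..d} (\<lambda>s. 1 / a s)"
  have sub: "{c..d} \<subseteq> {-1<..<1}" using cd by auto
  define E where "E = {x \<in> {-1<..<1}. \<not> (w has_real_derivative g x) (at x)}"
  have "E \<in> null_sets lebesgue"
    using der by (simp add: AE_restrict_space_iff completion.AE_iff_null_sets E_def)
  then have E: "negligible E" using negligible_iff_null_sets by blast
  have ac: "abs_continuous_on c d w"
    using w cd False by (simp add: loc_abs_continuous_def)
  have ftc: "(g has_integral (w d - w c)) {c..d}"
    using abs_continuous_on_has_integral[OF ac _ E] cd sub by (auto simp: E_def)
  have gint: "integrable space_meas (\<lambda>x. (sqrt (a x) * g x)\<^sup>2)"
    using g by (simp add: Lp_2_iff)
  have gHK: "(\<lambda>x. (sqrt (a x) * g x)\<^sup>2) integrable_on {-1<..<1}"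
    using gint by (rule integrable_on_lebesgue_on) simp
  have gHK': "(\<lambda>x. (sqrt (a x) * g x)\<^sup>2) integrable_on {c..d}"
    using gHK sub by (rule integrable_on_subinterval)
  have "integral {c..d} (\<lambda>x. (sqrt (a x) * g x)\<^sup>2) \<le> integral {-1<..<1} (\<lambda>x. (sqrt (a x) * g x)\<^sup>2)"
    using sub gHK' gHK by (intro integral_subset_le) auto
  also have "\<dots> = ?N"
    using lebesgue_integral_eq_integral[OF gint] by (simp add: Lp_norm_2_sq)
  finally have N: "integral {c..d} (\<lambda>x. (sqrt (a x) * g x)\<^sup>2) \<le> ?N" .
  have aHK: "(\<lambda>s. 1 / a s) integrable_on {c..d}"
    using continuous_inverse_weight[OF sub] by (rule integrable_continuous_real)
  have "2 * l * \<bar>w d - w c\<bar> \<le> l\<^sup>2 * ?N + ?J" if l: "l > 0" for l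
  proof -
    have "norm (integral {c..d} (\<lambda>x. 2 * l * g x))
        \<le> integral {c..d} (\<lambda>x. l\<^sup>2 * (sqrt (a x) * g x)\<^sup>2 + 1 / a x)"
    proof (rule Henstock_Kurzweil_Integration.integral_norm_bound_integral)
      show "(\<lambda>x. 2 * l * g x) integrable_on {c..d}"
        using ftc by (intro integrable_on_mult_right) (auto simp: integrable_on_def)
      show "(\<lambda>x. l\<^sup>2 * (sqrt (a x) * g x)\<^sup>2 + 1 / a x) integrable_on {c..d}"
        using gHK' aHK by (intro integrable_add integrable_on_mult_right)
      fix x assume "x \<in> {c..d}"
      then have ax: "a x > 0" using a_pos sub by blast
      \<comment> \<open>The weights sqrt a and 1 / sqrt a cancel in the cross term of this square,
        leaving 2 l |g|.\<close>
      have "0 \<le> (l * (sqrt (a x) * \<bar>g x\<bar>) - 1 / sqrt (a x))\<^sup>2" by simp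
      also have "\<dots> = l\<^sup>2 * (sqrt (a x) * g x)\<^sup>2 + 1 / a x - 2 * l * \<bar>g x\<bar>"
        using ax by (simp add: power2_diff power_mult_distrib power_divide)
      finally show "norm (2 * l * g x) \<le> l\<^sup>2 * (sqrt (a x) * g x)\<^sup>2 + 1 / a x"
        using l by (simp add: abs_mult)
    qed
    also have "\<dots> = l\<^sup>2 * integral {c..d} (\<lambda>x. (sqrt (a x) * g x)\<^sup>2) + ?J"
      using Henstock_Kurzweil_Integration.integral_add[OF integrable_on_mult_right[OF gHK'] aHK]
      by simp
    also have "\<dots> \<le> l\<^sup>2 * ?N + ?J"
      using N by (simp add: mult_left_mono)
    finally show ?thesis
      using l integral_unique[OF ftc] by (simp add: abs_mult)
  qed
  then have "\<bar>w d - w c\<bar>\<^sup>2 \<le> ?J * ?N"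
    by (intro sq_le_mult_of_quadratic) auto
  then show ?thesis by simp
qed auto

lemma loc_abs_continuous_sq_le_xi:
  assumes w: "loc_abs_continuous w"
    and der: "AE x in space_meas. (w has_real_derivative g x) (at x)"
    and g: "(\<lambda>x. sqrt (a x) * g x) \<in> L2"
    and x: "x \<in> {-1<..<1}"
  shows "(w x - w 0)\<^sup>2 \<le> \<bar>xi a x\<bar> * (L2_norm (\<lambda>x. sqrt (a x) * g x))\<^sup>2"
proof (cases "0 \<le> x")
  case True
  then have "(w x - w 0)\<^sup>2 \<le> xi a x * (L2_norm (\<lambda>x. sqrt (a x) * g x))\<^sup>2"
    using loc_abs_continuous_increment_sq_le[OF w der g, of 0 x] x by (simp add: xi_eq_integral)
  also have "\<dots> \<le> \<bar>xi a x\<bar> * (L2_norm (\<lambda>x. sqrt (a x) * g x))\<^sup>2"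
    by (intro mult_right_mono) auto
  finally show ?thesis .
next
  case False
  then have "(w 0 - w x)\<^sup>2 \<le> - xi a x * (L2_norm (\<lambda>x. sqrt (a x) * g x))\<^sup>2"
    using loc_abs_continuous_increment_sq_le[OF w der g, of x 0] x by (simp add: xi_eq_integral)
  also have "\<dots> \<le> \<bar>xi a x\<bar> * (L2_norm (\<lambda>x. sqrt (a x) * g x))\<^sup>2"
    by (intro mult_right_mono) auto
  finally show ?thesis by (simp add: power2_commute)
qed

text \<open>Supplies one constant for |xi_a| on [0, 1/2], the interval over which w(0) is
  averaged.\<close>

lemma xi_le_xi_half:
  assumes "y \<in> {0..1/2}"
  shows "\<bar>xi a y\<bar> \<le> xi a (1/2)"
proof -
  have int: "(\<lambda>s. 1 / a s) integrable_on {0..z}" if "z \<in> {0..1/2}" for z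
    using that by (intro integrable_continuous_real continuous_inverse_weight) auto
  have nonneg: "1 / a s \<ge> 0" if "s \<in> {0..1/2}" for s
    using a_pos[of s] that by auto
  have "0 \<le> integral {0..y} (\<lambda>s. 1 / a s)"
    using int assms nonneg by (intro Henstock_Kurzweil_Integration.integral_nonneg) auto
  moreover have "integral {0..y} (\<lambda>s. 1 / a s) \<le> integral {0..1/2} (\<lambda>s. 1 / a s)"
    using int assms nonneg by (intro integral_subset_le) auto
  ultimately show ?thesis
    using assms by (simp add: xi_eq_integral)
qed

lemma H1a_sq_le:
  assumes u: "u \<in> H1a a"
  shows "AE x in space_meas. (u x)\<^sup>2 \<le> (H1a_norm a u)\<^sup>2 * (8 + 4 * xi a (1/2) + 2 * \<bar>xi a x\<bar>)"
proof -
  \<comment> \<open>\<open>x_deriv\<close> is a choice; membership in \<open>H1a\<close> ensures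
    that a derivative exists, so the chosen g is one.\<close>
  define g where "g = x_deriv u"
  have "has_x_deriv u g"
    using u someI_ex[of "has_x_deriv u"] by (simp add: H1a_def g_def x_deriv_def)
  then obtain w where w: "loc_abs_continuous w" and uw: "AE x in space_meas. u x = w x"
    and der: "AE x in space_meas. (w has_real_derivative g x) (at x)"
    by (auto simp: has_x_deriv_def)
  have g: "(\<lambda>x. sqrt (a x) * g x) \<in> L2" and uL2: "u \<in> L2"
    using u by (simp_all add: H1a_def g_def)
  define N where "N = (L2_norm (\<lambda>x. sqrt (a x) * g x))\<^sup>2"
  define A where "A = xi a (1/2)"
  define M where "M = (H1a_norm a u)\<^sup>2"
  have M: "M = (L2_norm u)\<^sup>2 + N"
    by (simp add: M_def H1a_norm_def N_def g_def)
  have N0: "N \<ge> 0" and M0: "M \<ge> 0" by (simp_all add: N_def M_def)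
  have A0: "A \<ge> 0" using xi_le_xi_half[of 0] by (simp add: A_def)
  note incr = loc_abs_continuous_sq_le_xi[OF w der g, folded N_def]
  \<comment> \<open>The right side minus the left side is (s - 2 r)^2.\<close>
  have two_sq: "s\<^sup>2 \<le> 2 * r\<^sup>2 + 2 * (s - r)\<^sup>2" for s r :: real
    using zero_le_power2[of "s - 2 * r"] by (simp add: power2_eq_square algebra_simps)
  have "emeasure space_meas {0..1/2::real} = ennreal (1/2)"
    by (subst emeasure_restrict_space) auto
  moreover from this have meas: "measure space_meas {0..1/2::real} = 1/2"
    by (rule measure_eq_emeasure_eq_ennreal[rotated]) simp
  ultimately have meas_fin: "emeasure space_meas {0..1/2::real} < \<infinity>"
    unfolding infinity_ennreal_def by (metis ennreal_less_top)
  have int1: "integrable space_meas (\<lambda>x. indicator {0..1/2} x * k)" for k :: real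
    using meas_fin by (intro integrable_mult_left integrable_real_indicator) (auto simp: sets_restrict_space_iff)
  have int2: "integrable space_meas (\<lambda>x. (u x)\<^sup>2)"
    using uL2 by (simp add: Lp_2_iff)
  \<comment> \<open>Since [0, 1/2] has length 1/2, the two sides become (w 0)^2 / 2 and 2 ||u||^2 +
    A N.\<close>
  have "(LINT x|space_meas. indicator {0..1/2} x * (w 0)\<^sup>2)
      \<le> (LINT x|space_meas. 2 * (u x)\<^sup>2 + indicator {0..1/2} x * (2 * A * N))"
  proof (rule integral_mono_AE)
    show "AE x in space_meas. indicator {0..1/2} x * (w 0)\<^sup>2 \<le> 2 * (u x)\<^sup>2 + indicator {0..1/2} x * (2 * A * N)"
      using uw
    proof eventually_elim
      case (elim x)
      show ?case
      proof (cases "x \<in> {0..1/2}")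
        case True
        have "(w x - w 0)\<^sup>2 \<le> A * N"
          using incr[of x] xi_le_xi_half[OF True] True N0
            mult_right_mono[of "\<bar>xi a x\<bar>" A N] by (auto simp: A_def)
        then show ?thesis
          using True two_sq[of "w 0" "w x"] elim by (simp add: power2_commute)
      qed simp
    qed
  qed (use int1 int2 in auto)
  moreover have "{0..1/2} \<inter> {-1<..<1} = {0..1/2::real}" by auto
  ultimately have "(w 0)\<^sup>2 / 2 \<le> 2 * (L2_norm u)\<^sup>2 + A * N"
    using int1 int2 by (simp add: Lp_norm_2_sq meas)
  also have "\<dots> \<le> (2 + A) * M"
    using N0 A0 by (simp add: M algebra_simps)
  finally have w0: "(w 0)\<^sup>2 \<le> (4 + 2 * A) * M" by (simp add: algebra_simps)
  have "AE x in space_meas. x \<in> {-1<..<1::real}"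
    by (simp add: AE_restrict_space_iff)
  then show ?thesis
    using uw
  proof eventually_elim
    case (elim x)
    \<comment> \<open>The second use of \<open>two_sq\<close> doubles the factor 4 + 2 A from
      \<open>w0\<close>, which gives 8 + 4 A.\<close>
    have "(w x)\<^sup>2 \<le> 2 * (w 0)\<^sup>2 + 2 * (w x - w 0)\<^sup>2" by (rule two_sq)
    also have "\<dots> \<le> 2 * ((4 + 2 * A) * M) + 2 * (\<bar>xi a x\<bar> * M)"
      using w0 incr[OF elim(1)] mult_left_mono[of N M "\<bar>xi a x\<bar>"] by (simp add: M)
    finally show ?case using elim(2) by (simp add: A_def M_def algebra_simps)
  qed
qed

text \<open>One factor |u| is kept for the L2 norm and the pointwise bound is applied to the other
  2p - 1. That bound carries a square root of the weight, which Cauchy-Schwarz squares away, so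
  integrability of |xi_a|^(2p-1) is exactly what makes C finite. C is fixed before u.\<close>

lemma nn_integral_H1a_powr_le:
  assumes p: "p \<ge> 1" and xi: "xi a \<in> Lp space_meas (2 * p - 1)"
  obtains C where "C > 0"
    "\<And>u. u \<in> H1a a \<Longrightarrow> (\<integral>\<^sup>+x. ennreal (\<bar>u x\<bar> powr (2 * p)) \<partial>space_meas)
        \<le> ennreal (C * L2_norm u * H1a_norm a u powr (2 * p - 1))"
proof -
  define q where "q = 2 * p - 1"
  have q: "q \<ge> 1" using p by (simp add: q_def)
  define B where "B = 8 + 4 * xi a (1/2)"
  have B: "B \<ge> 0" using xi_le_xi_half[of 0] by (simp add: B_def)
  define H where "H x = (B + 2 * \<bar>xi a x\<bar>) powr q" for x
  have xim[measurable]: "xi a \<in> borel_measurable space_meas"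
    and xiint: "integrable space_meas (\<lambda>x. \<bar>xi a x\<bar> powr q)"
    using xi by (simp_all add: Lp_def q_def)
  have Hm[measurable]: "H \<in> borel_measurable space_meas"
    unfolding H_def by measurable
  have "integrable space_meas H"
  proof (rule Bochner_Integration.integrable_bound)
    have "integrable space_meas (\<lambda>x. (2 * B) powr q)"
      by (intro finite_measure.integrable_const finite_measure_restrict_space finite_measure_lebesgue_on) auto
    then show "integrable space_meas (\<lambda>x. (2 * B) powr q + 4 powr q * \<bar>xi a x\<bar> powr q)"
      using xiint by auto
    have "norm (H x) \<le> norm ((2 * B) powr q + 4 powr q * \<bar>xi a x\<bar> powr q)" for x
    proof -
      \<comment> \<open>A sum of two terms is at most twice the larger one; this splits the power
        without a convexity inequality.\<close>
      have "H x \<le> (max (2 * B) (4 * \<bar>xi a x\<bar>)) powr q"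
        unfolding H_def using B q by (intro powr_mono2) auto
      also have "\<dots> \<le> (2 * B) powr q + (4 * \<bar>xi a x\<bar>) powr q"
        by (auto simp: max_def)
      finally show ?thesis by (simp add: powr_mult H_def)
    qed
    then show "AE x in space_meas. norm (H x) \<le> norm ((2 * B) powr q + 4 powr q * \<bar>xi a x\<bar> powr q)"
      by simp
  qed simp
  then have Hnn: "(\<integral>\<^sup>+x. ennreal (H x) \<partial>space_meas) = ennreal (LINT x|space_meas. H x)"
    by (rule nn_integral_eq_integral) (simp add: H_def)
  \<comment> \<open>The added 1 makes C positive without a lower bound on the integral of H.\<close>
  define C where "C = sqrt (LINT x|space_meas. H x) + 1"
  have H0: "(LINT x|space_meas. H x) \<ge> 0" by (simp add: H_def)
  have C0: "C > 0" using H0 by (simp add: C_def add_nonneg_pos)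
  show thesis
  proof (rule that[OF C0])
    fix u assume u: "u \<in> H1a a"
    define M where "M = H1a_norm a u"
    have M: "M \<ge> 0" by (simp add: M_def H1a_norm_def)
    have uL2: "u \<in> L2" using u by (simp add: H1a_def)
    then have um[measurable]: "u \<in> borel_measurable space_meas"
      and uint: "integrable space_meas (\<lambda>x. (u x)\<^sup>2)" by (simp_all add: Lp_2_iff)
    have L0: "L2_norm u \<ge> 0" by (simp add: Lp_norm_def)
    have unn: "(\<integral>\<^sup>+x. ennreal ((u x)\<^sup>2) \<partial>space_meas) = ennreal ((L2_norm u)\<^sup>2)"
      using uint by (simp add: nn_integral_eq_integral Lp_norm_2_sq)
    let ?I = "\<integral>\<^sup>+x. ennreal \<bar>u x\<bar> * ennreal (sqrt (H x)) \<partial>space_meas"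
    have "?I\<^sup>2 \<le> (\<integral>\<^sup>+x. (ennreal \<bar>u x\<bar>)\<^sup>2 \<partial>space_meas) * (\<integral>\<^sup>+x. (ennreal (sqrt (H x)))\<^sup>2 \<partial>space_meas)"
      by (intro Cauchy_Schwarz_nn_integral) auto
    also have "\<dots> = ennreal ((L2_norm u)\<^sup>2) * ennreal (LINT x|space_meas. H x)"
      using unn Hnn by (simp add: ennreal_power H_def)
    also have "\<dots> \<le> (ennreal (L2_norm u * C))\<^sup>2"
    proof -
      have "(LINT x|space_meas. H x) \<le> C\<^sup>2"
        using H0 by (simp add: C_def power2_sum)
      then show ?thesis
        using L0 H0 by (simp add: ennreal_mult' [symmetric] ennreal_power C_def power_mult_distrib mult_left_mono)
    qed
    finally have I: "?I \<le> ennreal (L2_norm u * C)"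
      using L0 C0 by (intro ennreal_le_of_sq_le) auto
    have "(\<integral>\<^sup>+x. ennreal (\<bar>u x\<bar> powr (2 * p)) \<partial>space_meas)
        \<le> (\<integral>\<^sup>+x. ennreal (M powr q) * (ennreal \<bar>u x\<bar> * ennreal (sqrt (H x))) \<partial>space_meas)"
    proof (rule nn_integral_mono_AE)
      show "AE x in space_meas. ennreal (\<bar>u x\<bar> powr (2 * p)) \<le> ennreal (M powr q) * (ennreal \<bar>u x\<bar> * ennreal (sqrt (H x)))"
        using H1a_sq_le[OF u]
      proof eventually_elim
        case (elim x)
        have "\<bar>u x\<bar> = ((u x)\<^sup>2) powr (1/2)" by (simp add: powr_half_sqrt)
        also have "\<dots> \<le> (M\<^sup>2 * (B + 2 * \<bar>xi a x\<bar>)) powr (1/2)"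
          using elim by (intro powr_mono2) (auto simp: M_def B_def)
        also have "\<dots> = M * (B + 2 * \<bar>xi a x\<bar>) powr (1/2)"
          using M B by (simp add: powr_mult powr_half_sqrt)
        finally have "\<bar>u x\<bar> powr q \<le> (M * (B + 2 * \<bar>xi a x\<bar>) powr (1/2)) powr q"
          using q by (intro powr_mono2) auto
        also have "\<dots> = M powr q * sqrt (H x)"
          using M B by (simp add: powr_mult powr_powr H_def powr_half_sqrt[symmetric] mult.commute)
        finally have *: "\<bar>u x\<bar> powr q \<le> M powr q * sqrt (H x)" .
        have "\<bar>u x\<bar> powr (2 * p) = \<bar>u x\<bar> * \<bar>u x\<bar> powr q"
          by (cases "u x = 0") (auto simp: q_def powr_mult_base)
        also have "\<dots> \<le> M powr q * (\<bar>u x\<bar> * sqrt (H x))"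
          using mult_left_mono[OF *, of "\<bar>u x\<bar>"] by (simp add: mult_ac)
        finally show ?case by (simp add: ennreal_mult' [symmetric] H_def)
      qed
    qed
    also have "\<dots> = ennreal (M powr q) * ?I"
      by (rule nn_integral_cmult) auto
    also have "\<dots> \<le> ennreal (M powr q) * ennreal (L2_norm u * C)"
      using I by (rule mult_left_mono) simp
    finally show "(\<integral>\<^sup>+x. ennreal (\<bar>u x\<bar> powr (2 * p)) \<partial>space_meas)
        \<le> ennreal (C * L2_norm u * H1a_norm a u powr (2 * p - 1))"
      by (simp add: ennreal_mult' [symmetric] M_def q_def mult_ac)
  qed
qed

end

section \<open>Essential bounds in time and integration over the cylinder\<close>

text \<open>\<open>real_of_ereal\<close> sends both infinities to 0, so they must be excluded before
  passing to reals. Finiteness excludes the upper one; nonnegativity of f on a space of nonzero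
  measure excludes the lower one.\<close>

lemma AE_le_real_esssup:
  fixes f :: "'a \<Rightarrow> real"
  assumes nz: "emeasure M (space M) \<noteq> 0" and f: "\<And>x. f x \<ge> 0"
    and fin: "esssup M (\<lambda>x. ereal (f x)) < \<infinity>"
  shows "AE x in M. f x \<le> real_of_ereal (esssup M (\<lambda>x. ereal (f x)))"
    and "real_of_ereal (esssup M (\<lambda>x. ereal (f x))) \<ge> 0"
proof -
  let ?s = "esssup M (\<lambda>x. ereal (f x))"
  have ae: "AE x in M. ereal (f x) \<le> ?s" by (rule esssup_AE)
  have "?s \<ge> 0"
  proof (rule ccontr)
    assume neg: "\<not> ?s \<ge> 0"
    from ae have "AE x in M. False"
    proof eventually_elim
      case (elim x)
      have "0 \<le> ereal (f x)" using f by simp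
      then have "0 \<le> ?s" using elim by (rule order_trans)
      then show ?case using neg by simp
    qed
    then show False using nz by (simp add: AE_iff_measurable[OF sets.top])
  qed
  then obtain r where r: "?s = ereal r" "r \<ge> 0" using fin by (cases ?s) auto
  show "AE x in M. f x \<le> real_of_ereal ?s" using ae r by simp
  show "real_of_ereal ?s \<ge> 0" using r by simp
qed

theorem lemma3p5:
  fixes a :: "real \<Rightarrow> real" and T p :: real
  assumes "C1_on {-1..1} a"
    and "\<And>x. x \<in> {-1<..<1} \<Longrightarrow> a x > 0"
    and "a (-1) = 0" and "a 1 = 0"
    and "T > 0" and "p \<ge> 1"
    and "xi a \<in> Lp space_meas (2 * p - 1)"
  shows "H1_L2 T \<inter> Linf_H1a a T \<subseteq> {u. case_prod u \<in> Lp (cyl_meas T) (2 * p)} \<and>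
    (\<exists>c>0. \<forall>u \<in> H1_L2 T \<inter> Linf_H1a a T.
       Lp_norm (cyl_meas T) (2 * p) (case_prod u)
         \<le> c * T powr (1 / (2 * p)) * H1_L2_norm T u powr (1 / (2 * p))
             * Linf_H1a_norm a T u powr (1 - 1 / (2 * p)))"
proof -
  have "continuous_on {-1..1} a"
    using assms(1) unfolding C1_on_def by (auto intro: DERIV_continuous_on)
  then have a_cont: "continuous_on {-1<..<1} a"
    by (rule continuous_on_subset) auto
  obtain C where C: "C > 0"
    "\<And>u. u \<in> H1a a \<Longrightarrow> (\<integral>\<^sup>+x. ennreal (\<bar>u x\<bar> powr (2 * p)) \<partial>space_meas)
        \<le> ennreal (C * L2_norm u * H1a_norm a u powr (2 * p - 1))"
    using nn_integral_H1a_powr_le[OF assms(2) a_cont assms(6,7)] by metis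
  have time: "emeasure (time_meas T) (space (time_meas T)) \<noteq> 0"
    using \<open>T > 0\<close> by (simp add: emeasure_restrict_space)
  have main: "case_prod u \<in> Lp (cyl_meas T) (2 * p) \<and>
      Lp_norm (cyl_meas T) (2 * p) (case_prod u)
         \<le> C powr (1 / (2 * p)) * T powr (1 / (2 * p)) * H1_L2_norm T u powr (1 / (2 * p))
             * Linf_H1a_norm a T u powr (1 - 1 / (2 * p))"
    if u: "u \<in> H1_L2 T" "u \<in> Linf_H1a a T" for u
  proof -
    define h where "h = H1_L2_norm T u"
    define m where "m = Linf_H1a_norm a T u"
    have um[measurable]: "case_prod u \<in> borel_measurable (cyl_meas T)"
      and uH: "AE t in time_meas T. u t \<in> H1a a"
      and fin: "esssup (time_meas T) (\<lambda>t. ereal ((H1a_norm a (u t))\<^sup>2)) < \<infinity>"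
      using u(2) by (auto simp: Linf_H1a_def bochner_measurable_def)
    have "integrable (time_meas T) (\<lambda>t. (L2_norm (u t))\<^sup>2)"
      using u(1) by (simp add: H1_L2_def L2_L2_def)
    then have "(\<lambda>t. ereal ((L2_norm (u t))\<^sup>2)) \<in> borel_measurable (time_meas T)"
      by measurable
    \<comment> \<open>The L2 norm is dominated by the \<open>H1a\<close> norm, so finiteness of its
      essential supremum is inherited from \<open>Linf_H1a\<close>.\<close>
    then have "esssup (time_meas T) (\<lambda>t. ereal ((L2_norm (u t))\<^sup>2))
        \<le> esssup (time_meas T) (\<lambda>t. ereal ((H1a_norm a (u t))\<^sup>2))"
      by (rule esssup_mono) (simp add: H1a_norm_def)
    then have fin': "esssup (time_meas T) (\<lambda>t. ereal ((L2_norm (u t))\<^sup>2)) < \<infinity>"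
      using fin by (rule le_less_trans)
    have le_m: "AE t in time_meas T. (H1a_norm a (u t))\<^sup>2 \<le> m\<^sup>2"
      using AE_le_real_esssup[OF time _ fin] by (simp add: m_def Linf_H1a_norm_def)
    \<comment> \<open>h^2 is the essential supremum plus this nonnegative integral, hence an upper
      bound for the former.\<close>
    have "0 \<le> (LINT t|time_meas T. (L2_norm (t_deriv T u t))\<^sup>2)" by simp
    then have "real_of_ereal (esssup (time_meas T) (\<lambda>t. ereal ((L2_norm (u t))\<^sup>2))) \<le> h\<^sup>2"
      using AE_le_real_esssup(2)[OF time _ fin'] by (simp add: h_def H1_L2_norm_def)
    then have le_h: "AE t in time_meas T. (L2_norm (u t))\<^sup>2 \<le> h\<^sup>2"
      using AE_le_real_esssup(1)[OF time _ fin'] by (auto elim: eventually_mono)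
    have "0 \<le> real_of_ereal (esssup (time_meas T) (\<lambda>t. ereal ((L2_norm (u t))\<^sup>2)))"
      using AE_le_real_esssup(2)[OF time _ fin'] by simp
    then have h0: "h \<ge> 0" by (simp add: h_def H1_L2_norm_def)
    have m0: "m \<ge> 0"
      using AE_le_real_esssup(2)[OF time _ fin] by (simp add: m_def Linf_H1a_norm_def)
    \<comment> \<open>K bounds the slice integrals uniformly in t, so integrating over (0, T)
      contributes a factor T.\<close>
    define K where "K = C * h * m powr (2 * p - 1)"
    have K0: "K \<ge> 0" using C(1) h0 by (simp add: K_def)
    have "AE t in time_meas T.
        (\<integral>\<^sup>+x. ennreal (\<bar>case_prod u (t, x)\<bar> powr (2 * p)) \<partial>space_meas) \<le> ennreal K"
      using uH le_m le_h
    proof eventually_elim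
      case (elim t)
      have "L2_norm (u t) \<le> h" "H1a_norm a (u t) \<le> m"
        using elim(2,3) h0 m0 power2_le_imp_le by blast+
      then have "C * L2_norm (u t) * H1a_norm a (u t) powr (2 * p - 1) \<le> K"
        unfolding K_def using C(1) h0 \<open>p \<ge> 1\<close>
        by (intro mult_mono powr_mono2) (auto simp: H1a_norm_def Lp_norm_def)
      then show ?case
        using C(2)[OF elim(1)] by (simp add: ennreal_leI order_trans)
    qed
    then have "(\<integral>\<^sup>+z. ennreal (\<bar>case_prod u z\<bar> powr (2 * p)) \<partial>cyl_meas T) \<le> ennreal K * emeasure lborel {0<..<T}"
      by (intro nn_integral_lebesgue_on_Times_le) auto
    then have nn: "(\<integral>\<^sup>+z. ennreal (\<bar>case_prod u z\<bar> powr (2 * p)) \<partial>cyl_meas T) \<le> ennreal (K * T)"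
      using \<open>T > 0\<close> K0 by (simp add: ennreal_mult)
    have "integrable (cyl_meas T) (\<lambda>z. \<bar>case_prod u z\<bar> powr (2 * p))"
      using nn by (intro integrableI_bounded) (auto intro: le_less_trans)
    then have "case_prod u \<in> Lp (cyl_meas T) (2 * p)"
      by (simp add: Lp_def)
    moreover have "(LINT z|cyl_meas T. \<bar>case_prod u z\<bar> powr (2 * p)) \<le> K * T"
      using nn K0 \<open>T > 0\<close> by (intro integral_real_bounded) auto
    then have "Lp_norm (cyl_meas T) (2 * p) (case_prod u) \<le> (K * T) powr (1 / (2 * p))"
      unfolding Lp_norm_def using \<open>p \<ge> 1\<close> by (intro powr_mono2) auto
    moreover have "(K * T) powr (1 / (2 * p))
        = C powr (1 / (2 * p)) * T powr (1 / (2 * p)) * h powr (1 / (2 * p)) * m powr (1 - 1 / (2 * p))"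
    proof -
      \<comment> \<open>Taking the root of order 2p turns the exponent 2p - 1 of m into that of the
        claim.\<close>
      have "(2 * p - 1) * (1 / (2 * p)) = 1 - 1 / (2 * p)"
        using \<open>p \<ge> 1\<close> by (simp add: field_simps)
      then show ?thesis
        using C(1) h0 m0 \<open>T > 0\<close> unfolding K_def by (simp only: powr_mult powr_powr mult_ac)
    qed
    ultimately show ?thesis by (simp add: h_def m_def)
  qed
  show ?thesis
  proof (intro conjI)
    show "H1_L2 T \<inter> Linf_H1a a T \<subseteq> {u. case_prod u \<in> Lp (cyl_meas T) (2 * p)}"
      using main by blast
    show "\<exists>c>0. \<forall>u \<in> H1_L2 T \<inter> Linf_H1a a T.
       Lp_norm (cyl_meas T) (2 * p) (case_prod u)
         \<le> c * T powr (1 / (2 * p)) * H1_L2_norm T u powr (1 / (2 * p))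
             * Linf_H1a_norm a T u powr (1 - 1 / (2 * p))"
      \<comment> \<open>The witness is positive because C is, and C was obtained before any u was
        fixed.\<close>
      using main C(1) by (intro exI[of _ "C powr (1 / (2 * p))"]) auto
  qed
qed

end
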